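(* Let $\Omega\subset\mathbb{C}^n$ be a domain. If $1\le q\le n$, then pointwise evaluation is not a bounded, linear functional on $L^2_{0,q}(\Omega)\cap\ker\bar\partial_q$.
   Context: $\mathcal{I}_q$ is the set of increasing $q$-tuples $J=(j_1,\dots,j_q)$ of integers with $1\le j_1<\cdots<j_q\le n$, and $d\bar z^J=d\bar z_{j_1}\wedge\cdots\wedge d\bar z_{j_q}$. $L^2_{0,q}(\Omega)$ is the Hilbert space of $(0,q)$-forms $\varphi=\sum_{J\in\mathcal{I}_q}\varphi_J\,d\bar z^J$ on $\Omega$ with coefficients $\varphi_J\in L^2(\Omega)$, with inner product $(f,\varphi)=\int_\Omega\langle f,\varphi\rangle\,dV$, where $dV$ is Lebesgue measure. $\bar\partial_q$ is the Cauchy-Riemann operator $\bar\partial$ acting on $(0,q)$-forms, and $\ker\bar\partial_q$ is its kernel. Since forms are not functions, pointwise evaluation is understood as the pointwise evaluation functionals $\varphi\mapsto\varphi_J$ (evaluated at a point $z$) for each $J\in\mathcal{I}_q$. Boundedness of evaluation $e_z(\varphi)=\varphi(z)$ means $|e_z(\varphi)|\le C\|\varphi\|_{L^2_{0,q}(\Omega)}$ for some constant $C$ that may depend on $z$ but not on $\varphi$. *)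

theory Defs
  imports "HOL-Analysis.Analysis"
begin

text \<open>
  Complex Euclidean space of dimension \<open>n\<close> is \<open>complex ^ 'n\<close> with \<open>n = CARD('n)\<close>; the linear order
  on the finite type \<open>'n\<close> plays the role of the order on \<open>{1, \<dots>, n}\<close>.
\<close>

definition incr_tuples :: "nat \<Rightarrow> 'n::linorder list set" where
  "incr_tuples q = {J. length J = q \<and> sorted_wrt (<) J}"

text \<open>
  A \<open>(0,q)\<close>-form is given by its coefficients: \<open>\<phi> J\<close> is the coefficient of \<open>dzbar\<^sup>J\<close>. Only the values
  \<open>\<phi> J z\<close> with \<open>J \<in> incr_tuples q\<close> and \<open>z \<in> \<Omega>\<close> are relevant; all notions below ignore the others.
\<close>

type_synonym 'n form = "'n list \<Rightarrow> complex ^ 'n \<Rightarrow> complex"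


subsection \<open>The Hilbert space of square-integrable forms\<close>

text \<open>
  Elements are representatives: functions rather than classes modulo equality almost everywhere, so
  \<open>L2_norm\<close> is only a seminorm on \<open>L2_forms\<close>. The \<open>dzbar\<^sup>J\<close> are taken to be pointwise orthonormal.
\<close>

definition L2_forms ::
    "nat \<Rightarrow> (complex ^ 'n::{finite,linorder}) set \<Rightarrow> 'n form set" where
  "L2_forms q \<Omega> = {\<phi>. \<forall>J\<in>incr_tuples q.
     \<phi> J \<in> borel_measurable (lebesgue_on \<Omega>) \<and>
     integrable (lebesgue_on \<Omega>) (\<lambda>z. (cmod (\<phi> J z))\<^sup>2)}"

definition L2_inner ::
    "nat \<Rightarrow> (complex ^ 'n::{finite,linorder}) set \<Rightarrow> 'n form \<Rightarrow> 'n form \<Rightarrow> complex" where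
  "L2_inner q \<Omega> f \<phi> =
     integral\<^sup>L (lebesgue_on \<Omega>) (\<lambda>z. \<Sum>J\<in>incr_tuples q. f J z * cnj (\<phi> J z))"

definition L2_norm ::
    "nat \<Rightarrow> (complex ^ 'n::{finite,linorder}) set \<Rightarrow> 'n form \<Rightarrow> real" where
  "L2_norm q \<Omega> \<phi> = sqrt (Re (L2_inner q \<Omega> \<phi> \<phi>))"


subsection \<open>Smooth functions and test functions\<close>

text \<open>Real differentiability of order \<open>k\<close> at the points of a set, which is meant to be open.\<close>

primrec Ck_on ::
    "nat \<Rightarrow> 'a::real_normed_vector set \<Rightarrow> ('a \<Rightarrow> 'b::real_normed_vector) \<Rightarrow> bool" where
  "Ck_on 0 S f \<longleftrightarrow> continuous_on S f"
| "Ck_on (Suc k) S f \<longleftrightarrow>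
     (\<forall>x\<in>S. f differentiable (at x)) \<and>
     (\<forall>v. Ck_on k S (\<lambda>x. frechet_derivative f (at x) v))"

definition smooth_on ::
    "'a::real_normed_vector set \<Rightarrow> ('a \<Rightarrow> 'b::real_normed_vector) \<Rightarrow> bool" where
  "smooth_on S f \<longleftrightarrow> (\<forall>k. Ck_on k S f)"

definition test_functions :: "'a::real_normed_vector set \<Rightarrow> ('a \<Rightarrow> complex) set" where
  "test_functions \<Omega> =
     {\<psi>. smooth_on UNIV \<psi> \<and> compact (closure {z. \<psi> z \<noteq> 0}) \<and> closure {z. \<psi> z \<noteq> 0} \<subseteq> \<Omega>}"


subsection \<open>The Cauchy-Riemann operator\<close>

text \<open>
  The derivative \<open>\<partial>\<psi>/\<partial>zbar\<^sub>k = (\<partial>\<psi>/\<partial>x\<^sub>k + \<i> \<partial>\<psi>/\<partial>y\<^sub>k) / 2\<close> at \<open>z\<close>.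
\<close>

definition wirtinger_zbar ::
    "'n::finite \<Rightarrow> (complex ^ 'n \<Rightarrow> complex) \<Rightarrow> complex ^ 'n \<Rightarrow> complex" where
  "wirtinger_zbar k \<psi> z =
     (frechet_derivative \<psi> (at z) (axis k 1) + \<i> * frechet_derivative \<psi> (at z) (axis k \<i>)) / 2"

text \<open>
  The coefficient of \<open>dzbar\<^sup>K\<close> in \<open>dzbar\<^sub>k \<and> dzbar\<^sup>J\<close>: moving \<open>dzbar\<^sub>k\<close> into its place costs one transposition
  for every entry of \<open>J\<close> below \<open>k\<close>.
\<close>

definition wedge_coeff :: "'n::linorder \<Rightarrow> 'n list \<Rightarrow> 'n list \<Rightarrow> complex" where
  "wedge_coeff k J K =
     (if k \<notin> set J \<and> K = insort k J then (- 1) ^ length (filter (\<lambda>j. j < k) J) else 0)"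

text \<open>
  \<open>g\<close> is the image of \<open>\<phi>\<close> under \<open>dbar_q\<close> in the sense of distributions on \<open>\<Omega>\<close>, where
  \<open>dbar_q \<phi> = (\<Sum>k. \<Sum>J. \<partial>\<phi>\<^sub>J/\<partial>zbar\<^sub>k dzbar\<^sub>k \<and> dzbar\<^sup>J)\<close>. The operator between the \<open>L\<^sup>2\<close> spaces has its maximal
  domain: all square-integrable \<open>\<phi>\<close> whose distributional image is again square-integrable.
  For \<open>q = n\<close> there are no increasing \<open>(q + 1)\<close>-tuples, so every form is in the kernel.
\<close>

definition is_dbar ::
    "nat \<Rightarrow> (complex ^ 'n::{finite,linorder}) set \<Rightarrow> 'n form \<Rightarrow> 'n form \<Rightarrow> bool" where
  "is_dbar q \<Omega> \<phi> g \<longleftrightarrow>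
     \<phi> \<in> L2_forms q \<Omega> \<and> g \<in> L2_forms (Suc q) \<Omega> \<and>
     (\<forall>K\<in>incr_tuples (Suc q). \<forall>\<psi>\<in>test_functions \<Omega>.
        integral\<^sup>L (lebesgue_on \<Omega>) (\<lambda>z. g K z * \<psi> z) =
        - (\<Sum>k\<in>UNIV. \<Sum>J\<in>incr_tuples q.
             wedge_coeff k J K * integral\<^sup>L (lebesgue_on \<Omega>) (\<lambda>z. \<phi> J z * wirtinger_zbar k \<psi> z)))"

definition ker_dbar ::
    "nat \<Rightarrow> (complex ^ 'n::{finite,linorder}) set \<Rightarrow> 'n form set" where
  "ker_dbar q \<Omega> = {\<phi>. is_dbar q \<Omega> \<phi> (\<lambda>K z. 0)}"


subsection \<open>Functionals and pointwise evaluation\<close>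

text \<open>
  A bounded linear functional takes the same value on forms that agree almost everywhere on \<open>\<Omega>\<close>,
  because their difference has norm zero; it is therefore a functional on the quotient.
\<close>

definition bounded_linear_functional ::
    "nat \<Rightarrow> (complex ^ 'n::{finite,linorder}) set \<Rightarrow> 'n form set \<Rightarrow> ('n form \<Rightarrow> complex) \<Rightarrow> bool" where
  "bounded_linear_functional q \<Omega> H e \<longleftrightarrow>
     (\<forall>\<phi>\<in>H. \<forall>\<psi>\<in>H. e (\<lambda>J z. \<phi> J z + \<psi> J z) = e \<phi> + e \<psi>) \<and>
     (\<forall>c. \<forall>\<phi>\<in>H. e (\<lambda>J z. c * \<phi> J z) = c * e \<phi>) \<and>
     (\<exists>C. \<forall>\<phi>\<in>H. cmod (e \<phi>) \<le> C * L2_norm q \<Omega> \<phi>)"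

text \<open>
  \<open>e\<close> is the evaluation \<open>\<phi> \<mapsto> \<phi>\<^sub>J(z)\<close> on \<open>H\<close>. The value at a point is an invariant of the class of
  \<open>\<phi>\<close> only if the class has a regular representative, so it is prescribed on the forms with smooth
  coefficients only. Prescribing it on an arbitrary representative would make evaluation unbounded
  for the trivial reason that values on a null set can be changed. Smooth coefficients form the
  smallest natural class, so that the fewest requirements are put on \<open>e\<close>.
\<close>

definition is_evaluation ::
    "nat \<Rightarrow> (complex ^ 'n::{finite,linorder}) set \<Rightarrow> 'n form set \<Rightarrow>
     complex ^ 'n::{finite,linorder} \<Rightarrow> 'n list \<Rightarrow> ('n form \<Rightarrow> complex) \<Rightarrow> bool" where
  "is_evaluation q \<Omega> H z J e \<longleftrightarrow>
     (\<forall>\<phi>\<in>H. (\<forall>I\<in>incr_tuples q. smooth_on \<Omega> (\<phi> I)) \<longrightarrow> e \<phi> = \<phi> J z)"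

end

theory Submission
  imports Defs "HOL-Probability.Distributions"
begin

text \<open>
  For \<open>q = 0\<close> the kernel of \<open>dbar\<close> consists of holomorphic functions, whose mean value property
  bounds point values by the \<open>L\<^sup>2\<close> norm. For \<open>q \<ge> 1\<close> the kernel contains the square-integrable
  forms \<open>dbar u\<close> with \<open>u\<close> a smooth \<open>(0, q - 1)\<close>-form, and these can concentrate at a point. Let
  \<open>J = j # I\<close>, and for \<open>m > 0\<close> put \<open>f\<^sub>m(w) = cnj (w\<^sub>j - z\<^sub>j) * exp (- m |w - z|\<^sup>2)\<close>
  (\<open>gauss_peak\<close>) and \<open>\<phi>\<^sub>m = dbar (f\<^sub>m dzbar\<^sup>I)\<close>. The following properties of \<open>\<phi>\<^sub>m\<close>
  contradict boundedness as \<open>m\<close> tends to infinity.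

  \<^item> The \<open>J\<close>-coefficient of \<open>\<phi>\<^sub>m\<close> at \<open>z\<close> is \<open>\<partial>f\<^sub>m/\<partial>zbar\<^sub>j (z) = 1\<close>
    (\<open>dbar_gauss_peak_at_centre\<close>).

  \<^item> The coefficients of \<open>\<phi>\<^sub>m\<close> are smooth, and their absolute values are at most a constant times
    \<open>exp (- m |w - z|\<^sup>2 / 2)\<close>, with a constant independent of \<open>m\<close> (\<open>dbar_gauss_peak_bound\<close>). So
    \<open>\<phi>\<^sub>m\<close> is square-integrable on every domain, and its norm tends to zero by dominated
    convergence (\<open>integral_scaled_gaussian_tendsto_0\<close>).

  \<^item> \<open>\<phi>\<^sub>m\<close> lies in the kernel of \<open>dbar\<close>, which is defined by testing against smooth functions with
    compact support (\<open>dbar_monomial_in_ker_dbar\<close>). This is the identity \<open>dbar \<circ> dbar = 0\<close>: the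
    integral of \<open>\<partial>f/\<partial>zbar\<^sub>l \<cdot> \<partial>\<psi>/\<partial>zbar\<^sub>k\<close> is symmetric in \<open>k\<close> and \<open>l\<close>
    (\<open>integral_wirtinger_zbar_symmetric\<close>), while the wedge product is antisymmetric
    (\<open>wedge_coeff_anticommute\<close>).
\<close>

section \<open>Exterior multiplication of increasing tuples\<close>

lemma finite_incr_tuples: "finite (incr_tuples q :: 'n::{finite,linorder} list set)"
proof (rule finite_subset)
  show "incr_tuples q \<subseteq> {J :: 'n list. set J \<subseteq> UNIV \<and> length J = q}"
    by (auto simp: incr_tuples_def)
qed (rule finite_lists_length_eq, simp)

lemma insort_in_incr_tuples:
  assumes "I \<in> incr_tuples p" and "l \<notin> set I"
  shows "insort l I \<in> incr_tuples (Suc p)"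
  using assms by (simp add: incr_tuples_def strict_sorted_iff sorted_insort distinct_insort)

lemma length_filter_less_insort:
  "length (filter (\<lambda>j. j < k) (insort l I)) = length (filter (\<lambda>j. j < k) I) + (if l < k then 1 else 0)"
  for k l :: "'n::linorder"
  by (induction I) auto

text \<open>
  At most one \<open>M\<close> contributes, namely the sorted tuple with entries \<open>l\<close> and those of \<open>I\<close>. This
  evaluates the coefficient of \<open>dzbar\<^sup>K\<close> in \<open>dzbar\<^sub>k \<and> (dzbar\<^sub>l \<and> dzbar\<^sup>I)\<close>.
\<close>

lemma sum_wedge_coeff:
  fixes k l :: "'n::{finite,linorder}"
  assumes "I \<in> incr_tuples p"
  shows "(\<Sum>M\<in>incr_tuples (Suc p). wedge_coeff k M K * wedge_coeff l I M) =
         (if l \<in> set I then 0 else wedge_coeff k (insort l I) K * (- 1) ^ length (filter (\<lambda>j. j < l) I))"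
proof (cases "l \<in> set I")
  case False
  have "(\<Sum>M\<in>incr_tuples (Suc p). wedge_coeff k M K * wedge_coeff l I M) =
        (\<Sum>M\<in>incr_tuples (Suc p). if M = insort l I
           then wedge_coeff k (insort l I) K * (- 1) ^ length (filter (\<lambda>j. j < l) I) else 0)"
    using False by (intro sum.cong) (auto simp: wedge_coeff_def)
  then show ?thesis
    using False insort_in_incr_tuples[OF assms False] by (simp add: finite_incr_tuples)
qed (simp add: wedge_coeff_def)

text \<open>
  This is \<open>dzbar\<^sub>k \<and> dzbar\<^sub>l = - dzbar\<^sub>l \<and> dzbar\<^sub>k\<close>. Inserting \<open>k\<close> and \<open>l\<close> in either order gives the
  same tuple. For distinct \<open>k\<close> and \<open>l\<close>, the index inserted last has to pass the other one in exactly
  one of the two orders, the one that inserts the smaller index first, so the signs are opposite.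
\<close>

lemma wedge_coeff_anticommute:
  fixes k l :: "'n::{finite,linorder}"
  assumes "I \<in> incr_tuples p"
  shows "(\<Sum>M\<in>incr_tuples (Suc p). wedge_coeff k M K * wedge_coeff l I M) =
         - (\<Sum>M\<in>incr_tuples (Suc p). wedge_coeff l M K * wedge_coeff k I M)"
proof (cases "k = l")
  case True
  then show ?thesis
    by (simp only: sum_wedge_coeff[OF assms]) (simp add: wedge_coeff_def set_insort_key)
next
  case False
  then show ?thesis
    unfolding sum_wedge_coeff[OF assms]
    unfolding wedge_coeff_def set_insort_key length_filter_less_insort power_add insort_left_comm[of k l I]
    by (cases "k \<in> set I"; cases "l \<in> set I"; cases "K = insort l (insort k I)"; cases "k < l"; simp)
qed

lemma wedge_coeff_hd:
  assumes "j # I \<in> incr_tuples q"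
  shows "wedge_coeff l I (j # I) = (if l = j then 1 else 0)"
proof (cases "l = j")
  case True
  have "\<And>i. i \<in> set I \<Longrightarrow> j < i" and "j \<notin> set I"
    using assms by (auto simp: incr_tuples_def)
  then have "insort j I = j # I" and "filter (\<lambda>i. i < j) I = []"
    by (auto intro!: insort_is_Cons simp: filter_empty_conv less_imp_le dest: less_asym)
  with True \<open>j \<notin> set I\<close> show ?thesis
    by (simp add: wedge_coeff_def)
next
  case False
  have "set (j # I) \<noteq> set (insort l I)" if "l \<notin> set I"
    using False that by (auto simp: set_insort_key)
  then have "j # I \<noteq> insort l I" if "l \<notin> set I"
    using that by metis
  with False show ?thesis
    by (auto simp: wedge_coeff_def)
qed

section \<open>Calculus of smooth functions\<close>

lemma frechet_derivative_eqI: "(f has_derivative f') (at x) \<Longrightarrow> frechet_derivative f (at x) = f'"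
  by (metis frechet_derivative_at)

lemma differentiable_has_frechet_derivative:
  "f differentiable (at x) \<Longrightarrow> (f has_derivative frechet_derivative f (at x)) (at x)"
  by (simp add: frechet_derivative_works)

text \<open>
  Openness of \<open>S\<close> makes the derivatives at its points depend on the values on \<open>S\<close> alone. With this congruence, a derivative may be replaced by an explicit formula
  for it, which is how the closure properties below are proved.
\<close>

lemma Ck_on_cong:
  assumes "open S" and "\<And>x. x \<in> S \<Longrightarrow> f x = g x" and "Ck_on k S f"
  shows "Ck_on k S g"
  using assms(2,3)
proof (induction k arbitrary: f g)
  case 0
  then show ?case
    by (auto cong: continuous_on_cong)
next
  case (Suc k)
  have der: "(g has_derivative frechet_derivative f (at x)) (at x)" if "x \<in> S" for x
    using Suc.prems that assms(1)
    by (auto intro: has_derivative_transform_within_open[OF differentiable_has_frechet_derivative])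
  have "Ck_on k S (\<lambda>x. frechet_derivative g (at x) v)" for v
  proof (rule Suc.IH)
    show "Ck_on k S (\<lambda>x. frechet_derivative f (at x) v)"
      using Suc.prems by simp
    show "frechet_derivative f (at x) v = frechet_derivative g (at x) v" if "x \<in> S" for x
      using frechet_derivative_eqI[OF der[OF that]] by simp
  qed
  then show ?case
    using der by (auto simp: differentiable_def)
qed

lemma Ck_on_SucI:
  assumes "open S" and "\<And>x. x \<in> S \<Longrightarrow> (f has_derivative f' x) (at x)"
    and "\<And>v. Ck_on k S (\<lambda>x. f' x v)"
  shows "Ck_on (Suc k) S f"
proof -
  have "Ck_on k S (\<lambda>x. frechet_derivative f (at x) v)" for v
    by (rule Ck_on_cong[OF assms(1) _ assms(3)]) (simp add: frechet_derivative_eqI[OF assms(2)])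
  then show ?thesis
    using assms(2) by (auto simp: differentiable_def)
qed

lemma Ck_on_Suc_imp_Ck_on: "Ck_on (Suc k) S f \<Longrightarrow> Ck_on k S f"
proof (induction k arbitrary: f)
  case 0
  then show ?case
    by (auto intro!: continuous_at_imp_continuous_on differentiable_imp_continuous_within)
next
  case (Suc k)
  have "f differentiable (at x)" if "x \<in> S" for x
    using Suc.prems that by simp
  moreover have "Ck_on k S (\<lambda>x. frechet_derivative f (at x) v)" for v
    by (rule Suc.IH) (use Suc.prems in simp)
  ultimately show ?case
    by simp
qed

lemma Ck_on_const: "Ck_on k S (\<lambda>x. c)"
  by (induction k arbitrary: c) auto

lemma Ck_on_bounded_linear:
  assumes "bounded_linear L"
  shows "Ck_on k S L"
proof (cases k)
  case 0
  then show ?thesis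
    by (simp add: assms linear_continuous_on)
next
  case (Suc m)
  have "(L has_derivative L) (at x)" for x
    using assms by (rule bounded_linear_imp_has_derivative)
  then show ?thesis
    using Suc frechet_derivative_eqI[of L L] by (auto simp: differentiable_def Ck_on_const)
qed

lemma Ck_on_add:
  assumes "open S" and "Ck_on k S f" and "Ck_on k S g"
  shows "Ck_on k S (\<lambda>x. f x + g x)"
  using assms(2,3)
proof (induction k arbitrary: f g)
  case (Suc k)
  show ?case
  proof (rule Ck_on_SucI[OF assms(1)])
    show "((\<lambda>x. f x + g x) has_derivative
        (\<lambda>v. frechet_derivative f (at x) v + frechet_derivative g (at x) v)) (at x)" if "x \<in> S" for x
      using Suc.prems that by (intro has_derivative_add differentiable_has_frechet_derivative) auto
  qed (use Suc in auto)
qed (auto intro: continuous_on_add)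

lemma Ck_on_mult:
  fixes f g :: "'a::real_normed_vector \<Rightarrow> 'b::real_normed_algebra"
  assumes "open S" and "Ck_on k S f" and "Ck_on k S g"
  shows "Ck_on k S (\<lambda>x. f x * g x)"
  using assms(2,3)
proof (induction k arbitrary: f g)
  case (Suc k)
  show ?case
  proof (rule Ck_on_SucI[OF assms(1)])
    show "((\<lambda>x. f x * g x) has_derivative
        (\<lambda>v. f x * frechet_derivative g (at x) v + frechet_derivative f (at x) v * g x)) (at x)"
      if "x \<in> S" for x
      using Suc.prems that by (intro has_derivative_mult differentiable_has_frechet_derivative) auto
    show "Ck_on k S (\<lambda>x. f x * frechet_derivative g (at x) v + frechet_derivative f (at x) v * g x)" for v
      using Suc.prems Suc.prems[THEN Ck_on_Suc_imp_Ck_on]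
      by (intro Ck_on_add[OF assms(1)] Suc.IH) auto
  qed
qed (auto intro: continuous_on_mult)

lemma Ck_on_exp:
  fixes f :: "'a::real_normed_vector \<Rightarrow> 'b::{real_normed_field,banach}"
  assumes "open S" and "Ck_on k S f"
  shows "Ck_on k S (\<lambda>x. exp (f x))"
  using assms(2)
proof (induction k)
  case (Suc k)
  show ?case
  proof (rule Ck_on_SucI[OF assms(1)])
    show "((\<lambda>x. exp (f x)) has_derivative (\<lambda>v. exp (f x) * frechet_derivative f (at x) v)) (at x)"
      if "x \<in> S" for x
      using Suc.prems that
      by (intro has_derivative_compose[OF differentiable_has_frechet_derivative
            DERIV_exp[unfolded has_field_derivative_def]]) auto
    show "Ck_on k S (\<lambda>x. exp (f x) * frechet_derivative f (at x) v)" for v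
      using Suc.prems Suc.IH[OF Ck_on_Suc_imp_Ck_on[OF Suc.prems]]
      by (intro Ck_on_mult[OF assms(1)]) auto
  qed
qed (auto intro: continuous_on_exp)

lemma smooth_on_const: "smooth_on S (\<lambda>x. c)"
  by (simp add: smooth_on_def Ck_on_const)

lemma smooth_on_bounded_linear: "bounded_linear L \<Longrightarrow> smooth_on S L"
  by (simp add: smooth_on_def Ck_on_bounded_linear)

lemma smooth_on_add:
  "open S \<Longrightarrow> smooth_on S f \<Longrightarrow> smooth_on S g \<Longrightarrow> smooth_on S (\<lambda>x. f x + g x)"
  by (simp add: smooth_on_def Ck_on_add)

lemma smooth_on_mult:
  fixes f g :: "'a::real_normed_vector \<Rightarrow> 'b::real_normed_algebra"
  shows "open S \<Longrightarrow> smooth_on S f \<Longrightarrow> smooth_on S g \<Longrightarrow> smooth_on S (\<lambda>x. f x * g x)"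
  by (simp add: smooth_on_def Ck_on_mult)

lemma smooth_on_exp:
  fixes f :: "'a::real_normed_vector \<Rightarrow> 'b::{real_normed_field,banach}"
  shows "open S \<Longrightarrow> smooth_on S f \<Longrightarrow> smooth_on S (\<lambda>x. exp (f x))"
  by (simp add: smooth_on_def Ck_on_exp)

lemma smooth_on_sum:
  assumes "open S" and "\<And>i. i \<in> I \<Longrightarrow> smooth_on S (f i)"
  shows "smooth_on S (\<lambda>x. \<Sum>i\<in>I. f i x)"
  using assms(2)
  by (induction I rule: infinite_finite_induct) (auto intro: smooth_on_const smooth_on_add[OF assms(1)])

lemma smooth_on_subset:
  assumes "smooth_on T f" and "S \<subseteq> T"
  shows "smooth_on S f"
proof -
  have "Ck_on k T f \<Longrightarrow> Ck_on k S f" for k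
    using assms(2) by (induction k arbitrary: f) (auto intro: continuous_on_subset)
  then show ?thesis
    using assms(1) by (simp add: smooth_on_def)
qed

lemma smooth_on_frechet_derivative:
  "smooth_on S f \<Longrightarrow> smooth_on S (\<lambda>x. frechet_derivative f (at x) v)"
  unfolding smooth_on_def by (metis Ck_on.simps(2))

lemma smooth_on_continuous_on: "smooth_on S f \<Longrightarrow> continuous_on S f"
  unfolding smooth_on_def by (metis Ck_on.simps(1))

lemma smooth_on_wirtinger_zbar:
  assumes "open S" and "smooth_on S f"
  shows "smooth_on S (wirtinger_zbar k f)"
proof -
  have "smooth_on S (\<lambda>x. (1 / 2) * (frechet_derivative f (at x) (axis k 1)
      + \<i> * frechet_derivative f (at x) (axis k \<i>)))"
    using assms by (intro smooth_on_mult smooth_on_add smooth_on_const smooth_on_frechet_derivative)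
  then show ?thesis
    by (simp add: wirtinger_zbar_def[abs_def])
qed

section \<open>Integration by parts\<close>

lemma Ck_on_1_continuous: "Ck_on 1 UNIV f \<Longrightarrow> continuous_on UNIV f"
  using Ck_on_Suc_imp_Ck_on[of 0 UNIV f] by simp

lemma Ck_on_1_continuous_frechet_derivative:
  "Ck_on 1 UNIV f \<Longrightarrow> continuous_on UNIV (\<lambda>x. frechet_derivative f (at x) v)"
  by simp

lemma has_derivative_along_line:
  assumes "f differentiable (at (x + s *\<^sub>R w))"
  shows "((\<lambda>s. f (x + s *\<^sub>R w)) has_derivative (\<lambda>h. h *\<^sub>R frechet_derivative f (at (x + s *\<^sub>R w)) w))
         (at s)"
proof -
  have "((\<lambda>s. x + s *\<^sub>R w) has_derivative (\<lambda>h. h *\<^sub>R w)) (at s)"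
    by (auto intro!: derivative_eq_intros)
  from has_derivative_compose[OF this differentiable_has_frechet_derivative[OF assms]]
  show ?thesis
    by (simp add: linear_cmul[OF linear_frechet_derivative[OF assms]])
qed

lemma norm_increment_le:
  assumes "\<And>y. f differentiable (at y)" and "0 \<le> t"
    and "\<And>s. 0 \<le> s \<Longrightarrow> s \<le> t \<Longrightarrow> norm (frechet_derivative f (at (x + s *\<^sub>R w)) w) \<le> B"
  shows "norm (f (x + t *\<^sub>R w) - f x) \<le> B * t"
proof -
  have "norm (f (x + t *\<^sub>R w) - f (x + 0 *\<^sub>R w)) \<le> B * norm (t - 0)"
  proof (rule differentiable_bound[where S = "{0..t}"])
    fix s assume s: "s \<in> {0..t}"
    show "((\<lambda>s. f (x + s *\<^sub>R w)) has_derivative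
        (\<lambda>h. h *\<^sub>R frechet_derivative f (at (x + s *\<^sub>R w)) w)) (at s within {0..t})"
      by (rule has_derivative_at_withinI[OF has_derivative_along_line[OF assms(1)]])
    show "onorm (\<lambda>h. h *\<^sub>R frechet_derivative f (at (x + s *\<^sub>R w)) w) \<le> B"
    proof (rule onorm_le)
      show "norm (h *\<^sub>R frechet_derivative f (at (x + s *\<^sub>R w)) w) \<le> B * norm h" for h :: real
        using mult_left_mono[OF assms(3)[of s], of "\<bar>h\<bar>"] s by (simp add: mult.commute)
    qed
  qed (use assms(2) in auto)
  then show ?thesis
    using assms(2) by simp
qed

lemma difference_quotient_tendsto:
  assumes "f differentiable (at x)"
  shows "(\<lambda>n. real (Suc n) *\<^sub>R (f (x + inverse (real (Suc n)) *\<^sub>R w) - f x))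
         \<longlonglongrightarrow> frechet_derivative f (at x) w"
proof -
  let ?D = "frechet_derivative f (at x) w" and ?t = "\<lambda>n. inverse (real (Suc n))"
  have "((\<lambda>s. f (x + s *\<^sub>R w)) has_derivative (\<lambda>h. h *\<^sub>R ?D)) (at 0)"
    using has_derivative_along_line[of f x 0 w] assms by simp
  then have "((\<lambda>s. (f (x + s *\<^sub>R w) - f x - s *\<^sub>R ?D) /\<^sub>R norm s) \<longlongrightarrow> 0) (at 0)"
    by (simp add: has_derivative_at_within)
  moreover have "filterlim ?t (at 0) sequentially"
    using LIMSEQ_inverse_real_of_nat by (simp add: filterlim_at)
  ultimately have "(\<lambda>n. (f (x + ?t n *\<^sub>R w) - f x - ?t n *\<^sub>R ?D) /\<^sub>R norm (?t n)) \<longlonglongrightarrow> 0"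
    by (rule filterlim_compose)
  moreover have "(f (x + ?t n *\<^sub>R w) - f x - ?t n *\<^sub>R ?D) /\<^sub>R norm (?t n) =
      real (Suc n) *\<^sub>R (f (x + ?t n *\<^sub>R w) - f x) - ?D" for n
    by (simp add: scaleR_diff_right del: of_nat_Suc)
  ultimately show ?thesis
    by (simp only: LIM_zero_iff)
qed

lemma integrable_continuous_compact_support:
  fixes f :: "'a::euclidean_space \<Rightarrow> 'b::{banach, second_countable_topology}"
  assumes "continuous_on UNIV f" and "compact K" and "\<And>x. x \<notin> K \<Longrightarrow> f x = 0"
  shows "integrable lborel f"
proof -
  have "integrable lborel (\<lambda>x. indicator K x *\<^sub>R f x)"
    using assms(1,2) by (intro borel_integrable_compact) (auto intro: continuous_on_subset)
  moreover have "(\<lambda>x. indicator K x *\<^sub>R f x) = f"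
    using assms(3) by (auto simp: fun_eq_iff indicator_def)
  ultimately show ?thesis
    by simp
qed

lemma integral_lborel_translate:
  fixes f :: "'a::euclidean_space \<Rightarrow> 'b::{banach, second_countable_topology}"
  assumes "f \<in> borel_measurable borel"
  shows "(\<integral>x. f (x + a) \<partial>lborel) = (\<integral>x. f x \<partial>lborel)"
proof -
  have "(\<integral>x. f x \<partial>lborel) = (\<integral>x. f x \<partial>distr lborel borel ((+) a))"
    by (simp only: lborel_distr_plus)
  also have "\<dots> = (\<integral>x. f (a + x) \<partial>lborel)"
    using assms by (intro integral_distr) auto
  finally show ?thesis
    by (simp add: add.commute)
qed

lemma integrable_lborel_translate:
  fixes f :: "'a::euclidean_space \<Rightarrow> 'b::{banach, second_countable_topology}"
  assumes "integrable lborel f"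
  shows "integrable lborel (\<lambda>x. f (x + a))"
proof -
  have "integrable (distr lborel borel ((+) a)) f"
    using assms by (simp only: lborel_distr_plus)
  then have "integrable lborel (\<lambda>x. f (a + x))"
    using assms by (subst (asm) integrable_distr_eq) auto
  then show ?thesis
    by (simp add: add.commute)
qed

text \<open>
  Integration by parts and the symmetry of mixed derivatives, below, rest on this limit. The
  hypothesis \<open>van\<close> says that, for small steps in the direction \<open>w\<close>, the integrand lives on the fixed
  compact set \<open>K\<close>. There the difference quotients are bounded by the supremum of the directional
  derivative over the compact set swept out by \<open>K\<close>, so dominated convergence applies. Only the
  product is required to vanish off \<open>K\<close>, since in one use \<open>f\<close> has compact support and in another
  \<open>h\<close> has.
\<close>

lemma integral_difference_quotient_tendsto:
  fixes f h :: "'a::euclidean_space \<Rightarrow> complex"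
  assumes f: "Ck_on 1 UNIV f" and h: "continuous_on UNIV h" and "compact K"
    and van: "\<And>x t. x \<notin> K \<Longrightarrow> 0 \<le> t \<Longrightarrow> t \<le> 1 \<Longrightarrow> (f (x + t *\<^sub>R w) - f x) * h x = 0"
  shows "(\<lambda>n. \<integral>x. real (Suc n) *\<^sub>R (f (x + inverse (real (Suc n)) *\<^sub>R w) - f x) * h x \<partial>lborel)
         \<longlonglongrightarrow> (\<integral>x. frechet_derivative f (at x) w * h x \<partial>lborel)"
proof -
  let ?D = "\<lambda>x. frechet_derivative f (at x) w"
  let ?t = "\<lambda>n. inverse (real (Suc n))"
  let ?q = "\<lambda>n x. real (Suc n) *\<^sub>R (f (x + ?t n *\<^sub>R w) - f x) * h x"
  note contf = Ck_on_1_continuous[OF f]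
  let ?L = "(\<lambda>(x, s). x + s *\<^sub>R w) ` (K \<times> {0..1})"
  have "compact ?L"
    using \<open>compact K\<close> by (intro compact_continuous_image compact_Times)
      (auto intro!: continuous_intros simp: split_beta)
  have "continuous_on ?L ?D"
    by (rule continuous_on_subset[OF Ck_on_1_continuous_frechet_derivative[OF f]]) simp
  from compact_imp_bounded[OF compact_continuous_image[OF this \<open>compact ?L\<close>]]
  obtain B where B: "\<And>y. y \<in> ?L \<Longrightarrow> norm (?D y) \<le> B"
    unfolding bounded_iff by blast
  have "continuous_on K h"
    by (rule continuous_on_subset[OF h]) simp
  from compact_imp_bounded[OF compact_continuous_image[OF this \<open>compact K\<close>]]
  obtain M where M: "\<And>y. y \<in> K \<Longrightarrow> norm (h y) \<le> M"
    unfolding bounded_iff by blast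
  have bound: "norm (?q n x) \<le> B * M * indicator K x" for n x
  proof (cases "x \<in> K")
    case True
    have t: "0 \<le> ?t n" "?t n \<le> 1"
      by (auto simp: field_simps)
    have "norm (f (x + ?t n *\<^sub>R w) - f x) \<le> B * ?t n"
    proof (rule norm_increment_le)
      show "norm (?D (x + s *\<^sub>R w)) \<le> B" if "0 \<le> s" "s \<le> ?t n" for s
        using that t(2) True by (intro B) (auto intro!: image_eqI[where x = "(x, s)"])
    qed (use f t in auto)
    then have "real (Suc n) * norm (f (x + ?t n *\<^sub>R w) - f x) \<le> real (Suc n) * (B * ?t n)"
      by (rule mult_left_mono) simp
    then have *: "real (Suc n) * norm (f (x + ?t n *\<^sub>R w) - f x) \<le> B"
      by (simp add: field_simps del: of_nat_Suc)
    have "norm (?q n x) = real (Suc n) * norm (f (x + ?t n *\<^sub>R w) - f x) * norm (h x)"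
      by (simp add: norm_mult del: of_nat_Suc)
    also have "\<dots> \<le> B * M"
      using * M[OF True] by (intro mult_mono) (auto intro: order_trans[OF norm_ge_zero] order_trans[OF _ *])
    finally show ?thesis
      using True by simp
  next
    case False
    have "(f (x + ?t n *\<^sub>R w) - f x) * h x = 0"
      by (rule van[OF False]) (auto simp: field_simps)
    then show ?thesis
      using False by (auto simp del: of_nat_Suc)
  qed
  show ?thesis
  proof (rule integral_dominated_convergence[where w = "\<lambda>x. B * M * indicator K x"])
    show "integrable lborel (\<lambda>x. B * M * indicat_real K x)"
      using borel_integrable_compact[OF \<open>compact K\<close>, of "\<lambda>x. B * M"] by (simp add: mult.commute)
    show "(\<lambda>x. ?D x * h x) \<in> borel_measurable lborel"
      using f h by (auto intro!: borel_measurable_continuous_onI continuous_intros)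
    have "continuous_on UNIV (?q n)" for n
      using h by (intro continuous_intros continuous_on_compose2[OF contf]) auto
    then show "?q n \<in> borel_measurable lborel" for n
      using borel_measurable_continuous_onI by auto
    show "AE x in lborel. (\<lambda>n. ?q n x) \<longlonglongrightarrow> ?D x * h x"
      using f by (intro AE_I2 tendsto_mult tendsto_const difference_quotient_tendsto) auto
    show "AE x in lborel. norm (?q n x) \<le> B * M * indicator K x" for n
      using bound by (intro AE_I2)
  qed
qed

text \<open>
  The set \<open>L\<close> consists of the points that reach \<open>K\<close> by a step \<open>t *\<^sub>R w\<close> with \<open>0 \<le> t \<le> 1\<close>; it
  is the image of the compact set \<open>K \<times> {0..1}\<close>.
\<close>

lemma vanishing_translates:
  fixes w :: "'a::euclidean_space"
  assumes "compact K" and "\<And>x. x \<notin> K \<Longrightarrow> f x = 0"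
  obtains L where "compact L" and "K \<subseteq> L"
    and "\<And>x t. x \<notin> L \<Longrightarrow> 0 \<le> t \<Longrightarrow> t \<le> 1 \<Longrightarrow> f (x + t *\<^sub>R w) = 0"
proof
  let ?L = "(\<lambda>(x, s). x - s *\<^sub>R w) ` (K \<times> {0..1})"
  show "compact ?L"
    using \<open>compact K\<close> by (intro compact_continuous_image compact_Times)
      (auto intro!: continuous_intros simp: split_beta)
  show "K \<subseteq> ?L"
  proof
    show "x \<in> ?L" if "x \<in> K" for x
      using that by (intro image_eqI[where x = "(x, 0)"]) auto
  qed
  show "f (x + t *\<^sub>R w) = 0" if "x \<notin> ?L" "0 \<le> t" "t \<le> 1" for x t
  proof (rule assms(2))
    show "x + t *\<^sub>R w \<notin> K"
    proof
      assume "x + t *\<^sub>R w \<in> K"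
      then have "x \<in> ?L"
        using that by (intro image_eqI[where x = "(x + t *\<^sub>R w, t)"]) auto
      with that show False
        by blast
    qed
  qed
qed

text \<open>
  The integral of every difference quotient is zero, because Lebesgue measure is translation
  invariant; the integral of the derivative is their limit.
\<close>

lemma integral_frechet_derivative_eq_0:
  fixes f :: "'a::euclidean_space \<Rightarrow> complex"
  assumes f: "Ck_on 1 UNIV f" and "compact K" and van: "\<And>x. x \<notin> K \<Longrightarrow> f x = 0"
  shows "(\<integral>x. frechet_derivative f (at x) w \<partial>lborel) = 0"
proof -
  obtain L where L: "compact L" "K \<subseteq> L"
    "\<And>x t. x \<notin> L \<Longrightarrow> 0 \<le> t \<Longrightarrow> t \<le> 1 \<Longrightarrow> f (x + t *\<^sub>R w) = 0"
    by (rule vanishing_translates[where K = K and f = f and w = w]) (use assms(2,3) in auto)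
  note contf = Ck_on_1_continuous[OF f]
  have int: "integrable lborel f"
    by (rule integrable_continuous_compact_support[OF contf assms(2,3)])
  have "(f (x + t *\<^sub>R w) - f x) * 1 = 0" if "x \<notin> L" "0 \<le> t" "t \<le> 1" for x t
    using L(2) L(3)[OF that] van[of x] that by auto
  from integral_difference_quotient_tendsto[OF f continuous_on_const L(1) this]
  have "(\<lambda>n. \<integral>x. real (Suc n) *\<^sub>R (f (x + inverse (real (Suc n)) *\<^sub>R w) - f x) \<partial>lborel)
      \<longlonglongrightarrow> (\<integral>x. frechet_derivative f (at x) w \<partial>lborel)"
    by (simp del: of_nat_Suc)
  moreover have "(\<integral>x. real (Suc n) *\<^sub>R (f (x + inverse (real (Suc n)) *\<^sub>R w) - f x) \<partial>lborel) = 0" for n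
    using int integrable_lborel_translate[OF int] borel_measurable_continuous_onI[OF contf]
    by (simp add: integral_lborel_translate del: of_nat_Suc scaleR_conv_of_real)
  ultimately have "(\<lambda>n::nat. 0) \<longlonglongrightarrow> (\<integral>x. frechet_derivative f (at x) w \<partial>lborel)"
    by (simp only:)
  then show ?thesis
    by (simp add: LIMSEQ_const_iff)
qed

lemma frechet_derivative_vanishes_outside:
  assumes "closed K" and "\<And>x. x \<notin> K \<Longrightarrow> f x = 0" and "x \<notin> K"
  shows "frechet_derivative f (at x) v = 0"
proof -
  have "((\<lambda>_. 0) has_derivative (\<lambda>_. 0)) (at x)"
    by simp
  then have "(f has_derivative (\<lambda>_. 0)) (at x)"
    by (rule has_derivative_transform_within_open[where s = "- K"]) (use assms in auto)
  then show ?thesis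
    by (simp add: frechet_derivative_eqI)
qed

lemma integral_frechet_derivative_by_parts:
  fixes f g :: "'a::euclidean_space \<Rightarrow> complex"
  assumes f: "Ck_on 1 UNIV f" and g: "Ck_on 1 UNIV g" and "compact K"
    and van: "\<And>x. x \<notin> K \<Longrightarrow> g x = 0"
  shows "(\<integral>x. frechet_derivative f (at x) w * g x \<partial>lborel) =
         - (\<integral>x. f x * frechet_derivative g (at x) w \<partial>lborel)"
proof -
  let ?D = "\<lambda>f x. frechet_derivative f (at x) w"
  have "?D (\<lambda>x. f x * g x) x = f x * ?D g x + ?D f x * g x" for x
    using f g by (subst frechet_derivative_eqI[OF has_derivative_mult]) 
      (auto intro: differentiable_has_frechet_derivative)
  moreover have "(\<integral>x. ?D (\<lambda>x. f x * g x) x \<partial>lborel) = 0"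
    using van by (intro integral_frechet_derivative_eq_0[OF Ck_on_mult[OF open_UNIV f g] \<open>compact K\<close>]) simp
  ultimately have "(\<integral>x. f x * ?D g x + ?D f x * g x \<partial>lborel) = 0"
    by simp
  moreover have "integrable lborel (\<lambda>x. f x * ?D g x)"
    using g Ck_on_1_continuous[OF f]
      frechet_derivative_vanishes_outside[OF compact_imp_closed[OF \<open>compact K\<close>] van]
    by (intro integrable_continuous_compact_support[OF _ \<open>compact K\<close>]) (auto intro!: continuous_intros)
  moreover have "integrable lborel (\<lambda>x. ?D f x * g x)"
    using f Ck_on_1_continuous[OF g] van
    by (intro integrable_continuous_compact_support[OF _ \<open>compact K\<close>]) (auto intro!: continuous_intros)
  ultimately show ?thesis
    by (simp add: add_eq_0_iff)
qed

lemma has_derivative_translate: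
  assumes "Ck_on 1 UNIV g"
  shows "((\<lambda>x. g (x + a)) has_derivative frechet_derivative g (at (x + a))) (at x)"
proof -
  have "((\<lambda>x. x + a) has_derivative (\<lambda>h. h)) (at x)"
    by (auto intro!: derivative_eq_intros)
  from has_derivative_compose[OF this differentiable_has_frechet_derivative, of g]
  show ?thesis
    using assms by simp
qed

lemma frechet_derivative_translate:
  "Ck_on 1 UNIV g \<Longrightarrow>
    frechet_derivative (\<lambda>x. g (x + a)) (at x) = frechet_derivative g (at (x + a))"
  by (rule frechet_derivative_eqI[OF has_derivative_translate])

lemma Ck_on_1_translate:
  assumes "Ck_on 1 UNIV g"
  shows "Ck_on 1 UNIV (\<lambda>x. g (x + a))"
proof -
  have "Ck_on 0 UNIV (\<lambda>x. frechet_derivative g (at (x + a)) v)" for v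
    by (auto intro!: continuous_intros
        continuous_on_compose2[OF Ck_on_1_continuous_frechet_derivative[OF assms]])
  from Ck_on_SucI[OF open_UNIV has_derivative_translate[OF assms] this]
  show ?thesis
    by simp
qed

text \<open>
  For functions of class \<open>C\<^sup>2\<close> this is two integrations by parts together with the symmetry of second
  derivatives. Here one of the two derivatives is kept as a difference quotient instead, so that only
  first derivatives occur: with \<open>\<Delta>\<close> the increment by \<open>a\<close> and \<open>\<Delta>'\<close> the increment by \<open>-a\<close>, integration
  by parts in the direction \<open>v\<close> and translation give
  \<open>\<integral> D\<^sub>v f \<cdot> \<Delta> g = - \<integral> f \<cdot> \<Delta> (D\<^sub>v g) = - \<integral> \<Delta>' f \<cdot> D\<^sub>v g\<close>. Taking \<open>a\<close> to be a small
  multiple of \<open>w\<close> and passing to the limit proves the claim.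
\<close>

lemma integral_frechet_derivative_symmetric:
  fixes f g :: "'a::euclidean_space \<Rightarrow> complex"
  assumes f: "Ck_on 1 UNIV f" and g: "Ck_on 1 UNIV g" and "compact K"
    and van: "\<And>x. x \<notin> K \<Longrightarrow> g x = 0"
  shows "(\<integral>x. frechet_derivative f (at x) v * frechet_derivative g (at x) w \<partial>lborel) =
         (\<integral>x. frechet_derivative f (at x) w * frechet_derivative g (at x) v \<partial>lborel)"
proof -
  let ?D = "\<lambda>v f x. frechet_derivative f (at x) v"
  let ?t = "\<lambda>n. inverse (real (Suc n))"
  note contf = Ck_on_1_continuous[OF f] and contg = Ck_on_1_continuous[OF g]
  have contDf: "continuous_on UNIV (?D u f)" and contDg: "continuous_on UNIV (?D u g)" for u
    using f g by auto
  have vanD: "?D u g x = 0" if "x \<notin> K" for u x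
    by (rule frechet_derivative_vanishes_outside[OF compact_imp_closed[OF \<open>compact K\<close>] van that])
  obtain L where L: "compact L" "K \<subseteq> L"
    "\<And>x t. x \<notin> L \<Longrightarrow> 0 \<le> t \<Longrightarrow> t \<le> 1 \<Longrightarrow> g (x + t *\<^sub>R w) = 0"
    by (rule vanishing_translates[where K = K and f = g and w = w]) (use \<open>compact K\<close> van in auto)

  have "(g (x + t *\<^sub>R w) - g x) * ?D v f x = 0" if "x \<notin> L" "0 \<le> t" "t \<le> 1" for x t
    using L(2) L(3)[OF that] van[of x] that by auto
  from integral_difference_quotient_tendsto[OF g contDf L(1) this]
  have lim_g: "(\<lambda>n. \<integral>x. real (Suc n) *\<^sub>R (g (x + ?t n *\<^sub>R w) - g x) * ?D v f x \<partial>lborel)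
      \<longlonglongrightarrow> (\<integral>x. ?D w g x * ?D v f x \<partial>lborel)" .

  have "(f (x + t *\<^sub>R (- w)) - f x) * ?D v g x = 0" if "x \<notin> K" for x t
    using vanD[OF that] by simp
  from integral_difference_quotient_tendsto[OF f contDg \<open>compact K\<close> this]
  have lim_f: "(\<lambda>n. \<integral>x. real (Suc n) *\<^sub>R (f (x + ?t n *\<^sub>R (- w)) - f x) * ?D v g x \<partial>lborel)
      \<longlonglongrightarrow> (\<integral>x. ?D (- w) f x * ?D v g x \<partial>lborel)" .

  have quot: "(\<integral>x. (g (x + a) - g x) * ?D v f x \<partial>lborel) =
      - (\<integral>x. (f (x - a) - f x) * ?D v g x \<partial>lborel)" (is "?lhs = ?rhs") for a
  proof -
    let ?Ka = "(\<lambda>x. x - a) ` K"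
    have Ka: "compact ?Ka"
      using \<open>compact K\<close> by (intro compact_continuous_image) (auto intro!: continuous_intros)
    have inKa: "x + a \<notin> K" if "x \<notin> ?Ka" for x
      using that by (metis add_diff_cancel_right' imageI)
    have conts: "continuous_on UNIV (\<lambda>x. g (x + a))" "continuous_on UNIV (\<lambda>x. f (x - a))"
        "continuous_on UNIV (\<lambda>x. ?D v g (x + a))"
      by (auto intro!: continuous_intros continuous_on_compose2[OF contg]
          continuous_on_compose2[OF contf] continuous_on_compose2[OF contDg])
    note ga = Ck_on_1_translate[OF g, of a]
    have i1: "integrable lborel (\<lambda>x. g (x + a) * ?D v f x)"
      using conts contDf van inKa
      by (intro integrable_continuous_compact_support[OF _ Ka]) (auto intro!: continuous_intros)
    have i2: "integrable lborel (\<lambda>x. g x * ?D v f x)"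
      using contg contDf van
      by (intro integrable_continuous_compact_support[OF _ \<open>compact K\<close>]) (auto intro!: continuous_intros)
    have i3: "integrable lborel (\<lambda>x. f (x - a) * ?D v g x)"
      using conts contDg vanD
      by (intro integrable_continuous_compact_support[OF _ \<open>compact K\<close>]) (auto intro!: continuous_intros)
    have i4: "integrable lborel (\<lambda>x. f x * ?D v g x)"
      using contf contDg vanD
      by (intro integrable_continuous_compact_support[OF _ \<open>compact K\<close>]) (auto intro!: continuous_intros)
    have "?lhs = (\<integral>x. ?D v f x * g (x + a) \<partial>lborel) - (\<integral>x. ?D v f x * g x \<partial>lborel)"
      using i1 i2 by (simp add: algebra_simps)
    also have "(\<integral>x. ?D v f x * g (x + a) \<partial>lborel) = - (\<integral>x. f x * ?D v g (x + a) \<partial>lborel)"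
      using van inKa by (subst integral_frechet_derivative_by_parts[OF f ga Ka]) (auto simp: frechet_derivative_translate[OF g])
    also have "(\<integral>x. f x * ?D v g (x + a) \<partial>lborel) = (\<integral>x. f (x - a) * ?D v g x \<partial>lborel)"
    proof -
      have "(\<lambda>x. f (x - a) * ?D v g x) \<in> borel_measurable borel"
        using conts contDg by (intro borel_measurable_continuous_onI continuous_intros)
      from integral_lborel_translate[OF this, of a] show ?thesis
        by simp
    qed
    also have "(\<integral>x. ?D v f x * g x \<partial>lborel) = - (\<integral>x. f x * ?D v g x \<partial>lborel)"
      by (rule integral_frechet_derivative_by_parts[OF f g \<open>compact K\<close> van])
    finally show ?thesis
      using i3 i4 by (simp add: left_diff_distrib)
  qed
  have "(\<integral>x. real (Suc n) *\<^sub>R (g (x + ?t n *\<^sub>R w) - g x) * ?D v f x \<partial>lborel) =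
      - (\<integral>x. real (Suc n) *\<^sub>R (f (x + ?t n *\<^sub>R (- w)) - f x) * ?D v g x \<partial>lborel)" for n
    using quot[of "?t n *\<^sub>R w"] by (simp del: of_nat_Suc scaleR_conv_of_real)
  with lim_g have "(\<lambda>n. - (\<integral>x. real (Suc n) *\<^sub>R (f (x + ?t n *\<^sub>R (- w)) - f x) * ?D v g x \<partial>lborel))
      \<longlonglongrightarrow> (\<integral>x. ?D w g x * ?D v f x \<partial>lborel)"
    by simp
  from LIMSEQ_unique[OF this tendsto_minus[OF lim_f]]
  have "(\<integral>x. ?D w g x * ?D v f x \<partial>lborel) = - (\<integral>x. ?D (- w) f x * ?D v g x \<partial>lborel)" .
  moreover have "?D (- w) f x = - ?D w f x" for x
    using f by (intro linear_neg linear_frechet_derivative) auto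
  ultimately show ?thesis
    by (simp add: mult.commute)
qed

text \<open>
  The operators \<open>\<partial>/\<partial>zbar\<^sub>k\<close> are complex combinations, with constant coefficients, of directional
  derivatives, so the symmetry carries over by bilinearity.
\<close>

lemma integral_wirtinger_zbar_symmetric:
  fixes f g :: "complex ^ 'n \<Rightarrow> complex"
  assumes f: "Ck_on 1 UNIV f" and g: "Ck_on 1 UNIV g" and "compact K"
    and van: "\<And>x. x \<notin> K \<Longrightarrow> g x = 0"
  shows "(\<integral>x. wirtinger_zbar l f x * wirtinger_zbar k g x \<partial>lborel) =
         (\<integral>x. wirtinger_zbar k f x * wirtinger_zbar l g x \<partial>lborel)"
proof -
  let ?I = "\<lambda>v w. \<integral>x. frechet_derivative f (at x) v * frechet_derivative g (at x) w \<partial>lborel"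
  have vanD: "frechet_derivative g (at x) u = 0" if "x \<notin> K" for u x
    by (rule frechet_derivative_vanishes_outside[OF compact_imp_closed[OF \<open>compact K\<close>] van that])
  have int: "integrable lborel (\<lambda>x. frechet_derivative f (at x) v * frechet_derivative g (at x) w)" for v w
    using f g vanD
    by (intro integrable_continuous_compact_support[OF _ \<open>compact K\<close>]) (auto intro!: continuous_intros)
  have expand: "(\<integral>x. wirtinger_zbar l f x * wirtinger_zbar k g x \<partial>lborel) =
      (?I (axis l 1) (axis k 1) - ?I (axis l \<i>) (axis k \<i>)
        + \<i> * (?I (axis l 1) (axis k \<i>) + ?I (axis l \<i>) (axis k 1))) / 4" for k l
  proof -
    have eq: "wirtinger_zbar l f x * wirtinger_zbar k g x =
        (frechet_derivative f (at x) (axis l 1) * frechet_derivative g (at x) (axis k 1)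
          - frechet_derivative f (at x) (axis l \<i>) * frechet_derivative g (at x) (axis k \<i>)
          + \<i> * (frechet_derivative f (at x) (axis l 1) * frechet_derivative g (at x) (axis k \<i>)
            + frechet_derivative f (at x) (axis l \<i>) * frechet_derivative g (at x) (axis k 1))) / 4" for x
      unfolding wirtinger_zbar_def by (simp add: field_simps)
    show ?thesis
      unfolding eq using int by simp
  qed
  show ?thesis
    unfolding expand
    by (simp add: integral_frechet_derivative_symmetric[OF f g \<open>compact K\<close> van, of "axis l _"] add.commute)
qed

section \<open>The image of a smooth form lies in the kernel\<close>

text \<open>
  The coefficients of the form \<open>dbar (f dzbar\<^sup>I)\<close>.
\<close>

definition dbar_monomial ::
    "(complex ^ 'n::{finite,linorder} \<Rightarrow> complex) \<Rightarrow> 'n list \<Rightarrow> 'n form" where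
  "dbar_monomial f I M z = (\<Sum>l\<in>UNIV. wedge_coeff l I M * wirtinger_zbar l f z)"

lemma smooth_on_dbar_monomial:
  assumes "open \<Omega>" and "smooth_on \<Omega> f"
  shows "smooth_on \<Omega> (dbar_monomial f I M)"
  unfolding dbar_monomial_def[abs_def]
  using assms by (intro smooth_on_sum smooth_on_mult smooth_on_const smooth_on_wirtinger_zbar)

lemma integral_lebesgue_on_eq_lborel:
  fixes f :: "'a::euclidean_space \<Rightarrow> complex"
  assumes "open \<Omega>" and "continuous_on UNIV f" and "\<And>x. x \<notin> \<Omega> \<Longrightarrow> f x = 0"
  shows "integral\<^sup>L (lebesgue_on \<Omega>) f = integral\<^sup>L lborel f"
proof -
  have "integral\<^sup>L (lebesgue_on \<Omega>) f = (\<integral>x. indicator \<Omega> x *\<^sub>R f x \<partial>lebesgue)"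
    using assms(1) by (intro integral_restrict_space) auto
  also have "(\<lambda>x. indicator \<Omega> x *\<^sub>R f x) = f"
    using assms(3) by (auto simp: fun_eq_iff indicator_def)
  also have "integral\<^sup>L lebesgue f = integral\<^sup>L lborel f"
    using borel_measurable_continuous_onI[OF assms(2)] by (intro integral_completion) simp
  finally show ?thesis .
qed

text \<open>
  This is \<open>dbar \<circ> dbar = 0\<close> in the sense of distributions. Tested against \<open>\<psi>\<close>, the coefficient of
  \<open>dzbar\<^sup>K\<close> is \<open>\<Sum>k l. c k l * A l k\<close>, where \<open>A l k\<close> is the integral of
  \<open>\<partial>f/\<partial>zbar\<^sub>l \<cdot> \<partial>\<psi>/\<partial>zbar\<^sub>k\<close> and \<open>c k l\<close> is the coefficient of \<open>dzbar\<^sup>K\<close> in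
  \<open>dzbar\<^sub>k \<and> dzbar\<^sub>l \<and> dzbar\<^sup>I\<close>. The first is symmetric and the second antisymmetric in \<open>k\<close> and \<open>l\<close>,
  so the sum equals its own negative.
\<close>

lemma dbar_monomial_in_ker_dbar:
  fixes f :: "complex ^ 'n::{finite,linorder} \<Rightarrow> complex"
  assumes "open \<Omega>" and smooth: "smooth_on UNIV f" and I: "I \<in> incr_tuples p"
    and L2: "dbar_monomial f I \<in> L2_forms (Suc p) \<Omega>"
  shows "dbar_monomial f I \<in> ker_dbar (Suc p) \<Omega>"
proof -
  have "(\<Sum>k\<in>UNIV. \<Sum>M\<in>incr_tuples (Suc p). wedge_coeff k M K *
      integral\<^sup>L (lebesgue_on \<Omega>) (\<lambda>z. dbar_monomial f I M z * wirtinger_zbar k \<psi> z)) = 0"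
    (is "?total = 0") if "\<psi> \<in> test_functions \<Omega>" for \<psi> and K
  proof -
    let ?S = "closure {z. \<psi> z \<noteq> 0}"
    have \<psi>: "smooth_on UNIV \<psi>" "compact ?S" "?S \<subseteq> \<Omega>"
      using that by (auto simp: test_functions_def)
    have van: "\<psi> z = 0" if "z \<notin> ?S" for z
      using that closure_subset[of "{z. \<psi> z \<noteq> 0}"] by auto
    have vanW: "wirtinger_zbar k \<psi> z = 0" if "z \<notin> ?S" for k z
      using frechet_derivative_vanishes_outside[OF closed_closure van that]
      by (simp add: wirtinger_zbar_def)
    have C1: "Ck_on 1 UNIV f" "Ck_on 1 UNIV \<psi>"
      using smooth \<psi>(1) unfolding smooth_on_def by blast+
    have cont: "continuous_on UNIV (wirtinger_zbar k f)" "continuous_on UNIV (wirtinger_zbar k \<psi>)" for k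
      using smooth \<psi>(1) by (auto intro: smooth_on_continuous_on smooth_on_wirtinger_zbar)
    define A where "A l k = (\<integral>z. wirtinger_zbar l f z * wirtinger_zbar k \<psi> z \<partial>lborel)" for l k
    define c where "c k l = (\<Sum>M\<in>incr_tuples (Suc p). wedge_coeff k M K * wedge_coeff l I M)" for k l
    have A: "A l k = A k l" for k l
      unfolding A_def by (rule integral_wirtinger_zbar_symmetric[OF C1 \<psi>(2) van])
    have c: "c k l = - c l k" for k l
      unfolding c_def by (rule wedge_coeff_anticommute[OF I])
    have int: "integrable lborel (\<lambda>z. wirtinger_zbar l f z * wirtinger_zbar k \<psi> z)" for k l
      using cont vanW
      by (intro integrable_continuous_compact_support[OF _ \<psi>(2)]) (auto intro!: continuous_intros)
    have "integral\<^sup>L (lebesgue_on \<Omega>) (\<lambda>z. dbar_monomial f I M z * wirtinger_zbar k \<psi> z) =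
        (\<Sum>l\<in>UNIV. wedge_coeff l I M * A l k)" for M k
    proof -
      have "integral\<^sup>L (lebesgue_on \<Omega>) (\<lambda>z. dbar_monomial f I M z * wirtinger_zbar k \<psi> z) =
          (\<integral>z. dbar_monomial f I M z * wirtinger_zbar k \<psi> z \<partial>lborel)"
        using \<psi>(3) vanW cont unfolding dbar_monomial_def
        by (intro integral_lebesgue_on_eq_lborel[OF \<open>open \<Omega>\<close>] continuous_intros) auto
      also have "\<dots> = (\<Sum>l\<in>UNIV. wedge_coeff l I M * A l k)"
        using int by (simp add: dbar_monomial_def sum_distrib_right mult.assoc A_def)
      finally show ?thesis .
    qed
    then have "?total = (\<Sum>k\<in>UNIV. \<Sum>M\<in>incr_tuples (Suc p). \<Sum>l\<in>UNIV.
        wedge_coeff k M K * wedge_coeff l I M * A l k)"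
      by (simp add: sum_distrib_left mult.assoc)
    also have "\<dots> = (\<Sum>k\<in>UNIV. \<Sum>l\<in>UNIV. c k l * A l k)"
      by (subst sum.swap[of _ UNIV "incr_tuples (Suc p)"]) (simp add: c_def sum_distrib_right)
    finally have total: "?total = (\<Sum>k\<in>UNIV. \<Sum>l\<in>UNIV. c k l * A l k)" .
    also have "\<dots> = (\<Sum>k\<in>UNIV. \<Sum>l\<in>UNIV. - (c l k * A k l))"
      by (intro sum.cong refl) (metis A c mult_minus_left)
    also have "\<dots> = - (\<Sum>l\<in>UNIV. \<Sum>k\<in>UNIV. c l k * A k l)"
      by (subst sum.swap) (simp add: sum_negf)
    also have "\<dots> = - ?total"
      using total by simp
    finally show ?thesis
      by simp
  qed
  then have "is_dbar (Suc p) \<Omega> (dbar_monomial f I) (\<lambda>K z. 0)"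
    using L2 by (simp add: is_dbar_def L2_forms_def)
  then show ?thesis
    by (simp add: ker_dbar_def)
qed

section \<open>Gaussian weights\<close>

text \<open>
  By Tonelli's theorem the integral is a product of one-dimensional Gaussian integrals.
\<close>

lemma integrable_gaussian:
  fixes z :: "'a::euclidean_space"
  shows "integrable lborel (\<lambda>x. exp (- (norm (x - z))\<^sup>2))"
proof -
  have "integrable lborel (\<lambda>x::'a. exp (- (norm x)\<^sup>2))"
  proof (rule integrableI_nonneg)
    have prod: "ennreal (exp (- (norm x)\<^sup>2)) = (\<Prod>b\<in>Basis. ennreal (exp (- (x \<bullet> b)\<^sup>2)))" for x :: 'a
    proof -
      have "(norm x)\<^sup>2 = (\<Sum>b\<in>Basis. (x \<bullet> b)\<^sup>2)"
        unfolding power2_norm_eq_inner by (subst euclidean_inner) (simp add: power2_eq_square)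
      then show ?thesis
        by (simp add: prod_ennreal exp_sum sum_negf[symmetric])
    qed
    have "integrable lborel (\<lambda>x::real. exp (- x\<^sup>2))"
      using has_bochner_integral_even_function[OF gaussian_moment_0] by (simp add: has_bochner_integral_iff)
    then have "integral\<^sup>N lborel (\<lambda>x::real. ennreal (exp (- x\<^sup>2))) < \<infinity>"
      by (simp add: nn_integral_eq_integral)
    then show "integral\<^sup>N lborel (\<lambda>x::'a. ennreal (exp (- (norm x)\<^sup>2))) < \<infinity>"
      unfolding prod by (subst nn_integral_lborel_prod) (auto simp: power_less_top_ennreal)
  qed auto
  from integrable_lborel_translate[OF this, of "- z"] show ?thesis
    by simp
qed

text \<open>
  The functions tend to zero off the point \<open>z\<close> and are dominated by the Gaussian with \<open>n = 0\<close>.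
\<close>

lemma scaled_gaussian:
  fixes z :: "'a::euclidean_space"
  shows integrable_scaled_gaussian: "integrable lborel (\<lambda>x. exp (- (real (Suc n) * (norm (x - z))\<^sup>2)))"
    and integral_scaled_gaussian_tendsto_0:
      "(\<lambda>n. \<integral>x. exp (- (real (Suc n) * (norm (x - z))\<^sup>2)) \<partial>lborel) \<longlonglongrightarrow> 0"
proof -
  let ?g = "\<lambda>n x. exp (- (real (Suc n) * (norm (x - z))\<^sup>2))"
  have bound: "norm (?g n x) \<le> exp (- (norm (x - z))\<^sup>2)" for n x
    using mult_right_mono[of 1 "real (Suc n)" "(norm (x - z))\<^sup>2"] by (simp del: of_nat_Suc)
  have meas: "?g n \<in> borel_measurable lborel" for n
    by simp
  have "AE x in lborel. x \<noteq> z"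
    by (rule AE_lborel_singleton)
  then have lim: "AE x in lborel. (\<lambda>n. ?g n x) \<longlonglongrightarrow> 0"
  proof eventually_elim
    case (elim x)
    let ?a = "exp (- (norm (x - z))\<^sup>2)"
    have "(\<lambda>n. ?a ^ Suc n) \<longlonglongrightarrow> 0"
      using elim by (intro LIMSEQ_Suc LIMSEQ_power_zero) simp
    then show ?case
      by (simp add: exp_of_nat_mult[symmetric] del: of_nat_Suc power_Suc)
  qed
  show "integrable lborel (?g n)" for n
    by (rule integrable_dominated_convergence2[OF _ meas integrable_gaussian[of z] lim]) (use bound in auto)
  have "(\<lambda>n. integral\<^sup>L lborel (?g n)) \<longlonglongrightarrow> integral\<^sup>L lborel (\<lambda>x::'a. 0::real)"
    by (rule integral_dominated_convergence[OF _ meas integrable_gaussian[of z] lim]) (use bound in auto)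
  then show "(\<lambda>n. integral\<^sup>L lborel (?g n)) \<longlonglongrightarrow> 0"
    by simp
qed

lemma integrable_lebesgue_on_if_lborel:
  fixes f :: "'a::euclidean_space \<Rightarrow> real"
  assumes "open \<Omega>" and "integrable lborel f"
  shows "integrable (lebesgue_on \<Omega>) f"
proof -
  have "integrable lebesgue f"
    using assms(2) by (subst integrable_completion) auto
  then have "integrable lebesgue (\<lambda>x. indicator \<Omega> x *\<^sub>R f x)"
    using assms(1) by (intro integrable_mult_indicator) auto
  then show ?thesis
    using assms(1) by (subst integrable_restrict_space) auto
qed

lemma integral_lebesgue_on_le_lborel:
  fixes f :: "'a::euclidean_space \<Rightarrow> real"
  assumes "open \<Omega>" and "integrable lborel f" and "\<And>x. 0 \<le> f x"
  shows "integral\<^sup>L (lebesgue_on \<Omega>) f \<le> integral\<^sup>L lborel f"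
proof -
  have int: "integrable lebesgue f"
    using assms(2) by (subst integrable_completion) auto
  have "integral\<^sup>L (lebesgue_on \<Omega>) f = (\<integral>x. indicator \<Omega> x *\<^sub>R f x \<partial>lebesgue)"
    using assms(1) by (intro integral_restrict_space) auto
  also have "\<dots> \<le> integral\<^sup>L lebesgue f"
    using int assms(1,3) by (intro integral_mono integrable_mult_indicator) (auto simp: indicator_def)
  also have "\<dots> = integral\<^sup>L lborel f"
    using assms(2) by (intro integral_completion) auto
  finally show ?thesis .
qed

text \<open>
  The domain may have infinite measure; integrals over it are bounded by integrals of \<open>g\<close> over the
  whole space, once for each increasing tuple.
\<close>

lemma L2_forms_dominated:
  fixes \<phi> :: "'n::{finite,linorder} form"
  assumes "open \<Omega>" and cont: "\<And>I. continuous_on UNIV (\<phi> I)"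
    and g: "integrable lborel g" and bound: "\<And>I x. (cmod (\<phi> I x))\<^sup>2 \<le> g x"
  shows "\<phi> \<in> L2_forms q \<Omega>"
    and "0 \<le> L2_norm q \<Omega> \<phi>"
    and "L2_norm q \<Omega> \<phi> \<le> sqrt (card (incr_tuples q :: 'n list set) * integral\<^sup>L lborel g)"
proof -
  have sq: "integrable (lebesgue_on \<Omega>) (\<lambda>x. (cmod (\<phi> I x))\<^sup>2)" for I
  proof (rule integrable_lebesgue_on_if_lborel[OF \<open>open \<Omega>\<close>], rule Bochner_Integration.integrable_bound[OF g])
    show "(\<lambda>x. (cmod (\<phi> I x))\<^sup>2) \<in> borel_measurable lborel"
      using borel_measurable_continuous_onI[OF cont[of I]] by simp
    show "AE x in lborel. norm ((cmod (\<phi> I x))\<^sup>2) \<le> norm (g x)"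
      using bound[of I] by (intro AE_I2) (simp add: order_trans[OF _ abs_ge_self])
  qed
  have "\<phi> I \<in> borel_measurable (lebesgue_on \<Omega>)" for I
    using borel_measurable_continuous_onI[OF cont[of I]]
    by (intro measurable_restrict_space1 measurable_completion) simp
  with sq show "\<phi> \<in> L2_forms q \<Omega>"
    by (simp add: L2_forms_def)
  have g0: "0 \<le> g x" for x
    using order_trans[OF zero_le_power2 bound[of undefined x]] .
  have "L2_inner q \<Omega> \<phi> \<phi> =
      integral\<^sup>L (lebesgue_on \<Omega>) (\<lambda>x. complex_of_real (\<Sum>I\<in>incr_tuples q. (cmod (\<phi> I x))\<^sup>2))"
    by (simp add: L2_inner_def complex_norm_square del: of_real_power)
  then have Re: "Re (L2_inner q \<Omega> \<phi> \<phi>) =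
      integral\<^sup>L (lebesgue_on \<Omega>) (\<lambda>x. \<Sum>I\<in>incr_tuples q. (cmod (\<phi> I x))\<^sup>2)"
    by (simp only: integral_complex_of_real Re_complex_of_real)
  also have "\<dots> = (\<Sum>I\<in>incr_tuples q. integral\<^sup>L (lebesgue_on \<Omega>) (\<lambda>x. (cmod (\<phi> I x))\<^sup>2))"
    using sq by simp
  also have "\<dots> \<le> (\<Sum>I\<in>(incr_tuples q :: 'n list set). integral\<^sup>L lborel g)"
  proof (rule sum_mono)
    fix I
    have "integral\<^sup>L (lebesgue_on \<Omega>) (\<lambda>x. (cmod (\<phi> I x))\<^sup>2) \<le> integral\<^sup>L (lebesgue_on \<Omega>) g"
      using bound by (intro integral_mono sq integrable_lebesgue_on_if_lborel \<open>open \<Omega>\<close> g)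
    also have "\<dots> \<le> integral\<^sup>L lborel g"
      by (rule integral_lebesgue_on_le_lborel[OF \<open>open \<Omega>\<close> g g0])
    finally show "integral\<^sup>L (lebesgue_on \<Omega>) (\<lambda>x. (cmod (\<phi> I x))\<^sup>2) \<le> integral\<^sup>L lborel g" .
  qed
  finally show "L2_norm q \<Omega> \<phi> \<le> sqrt (card (incr_tuples q :: 'n list set) * integral\<^sup>L lborel g)"
    by (simp add: L2_norm_def)
  show "0 \<le> L2_norm q \<Omega> \<phi>"
    by (simp add: L2_norm_def Re sum_nonneg)
qed

section \<open>The concentrating forms\<close>

text \<open>
  With \<open>\<zeta> = w - z\<close> this is \<open>cnj \<zeta>\<^sub>j * exp (- m |\<zeta>|\<^sup>2)\<close>. The exponent is written as a
  polynomial in the \<open>\<zeta>\<^sub>k\<close> and their conjugates, so that smoothness and the derivatives with respect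
  to \<open>zbar\<^sub>l\<close> can be read off. The factor \<open>cnj \<zeta>\<^sub>j\<close> makes the derivative with respect to \<open>zbar\<^sub>j\<close>
  equal to \<open>1\<close> at \<open>z\<close>, whatever the value of \<open>m\<close>; the Gaussian is integrable over every domain,
  bounded or not.
\<close>

definition gauss_peak :: "'n \<Rightarrow> complex ^ 'n \<Rightarrow> real \<Rightarrow> complex ^ 'n::finite \<Rightarrow> complex" where
  "gauss_peak j z m w =
     cnj (w $ j - z $ j) * exp (\<Sum>k\<in>UNIV. - complex_of_real m * ((w $ k - z $ k) * cnj (w $ k - z $ k)))"

lemma smooth_on_gauss_peak: "smooth_on UNIV (gauss_peak j z m)"
proof -
  have coord: "smooth_on UNIV (\<lambda>w. w $ k - z $ k)" for k
    using smooth_on_add[OF open_UNIV smooth_on_bounded_linear[OF bounded_linear_vec_nth] smooth_on_const, of k "- (z $ k)"]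
    by simp
  have coord_cnj: "smooth_on UNIV (\<lambda>w. cnj (w $ k - z $ k))" for k
    using smooth_on_add[OF open_UNIV smooth_on_bounded_linear[OF bounded_linear_compose[OF bounded_linear_cnj bounded_linear_vec_nth]]
        smooth_on_const, of k "- cnj (z $ k)"]
    by simp
  show ?thesis
    unfolding gauss_peak_def[abs_def]
    by (intro smooth_on_mult smooth_on_exp smooth_on_sum open_UNIV smooth_on_const coord coord_cnj)
qed

text \<open>
  Every real-linear map splits into a complex-linear part and a conjugate-linear part; the operator
  \<open>\<partial>/\<partial>zbar\<^sub>l\<close> annihilates the former.
\<close>

lemma wirtinger_zbar_eqI:
  assumes "(f has_derivative (\<lambda>v. \<Sum>k\<in>UNIV. a k * v $ k + b k * cnj (v $ k))) (at w)"
  shows "wirtinger_zbar l f w = b l"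
proof -
  have "frechet_derivative f (at w) (axis l c) = a l * c + b l * cnj c" for c
  proof -
    have "(\<Sum>k\<in>UNIV. a k * axis l c $ k + b k * cnj (axis l c $ k)) =
        (\<Sum>k\<in>UNIV. if k = l then a l * c + b l * cnj c else 0)"
      by (intro sum.cong) (auto simp: axis_def)
    then show ?thesis
      by (simp add: frechet_derivative_eqI[OF assms])
  qed
  then show ?thesis
    by (simp add: wirtinger_zbar_def field_simps)
qed

lemma sum_mult_cnj_eq_norm:
  fixes x :: "complex ^ 'n"
  shows "(\<Sum>k\<in>UNIV. x $ k * cnj (x $ k)) = complex_of_real ((norm x)\<^sup>2)"
proof -
  have "(norm x)\<^sup>2 = (\<Sum>k\<in>UNIV. (cmod (x $ k))\<^sup>2)"
    by (simp add: norm_vec_def L2_set_def sum_nonneg)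
  then show ?thesis
    by (simp add: complex_norm_square del: of_real_power)
qed

lemma wirtinger_zbar_gauss_peak:
  "wirtinger_zbar l (gauss_peak j z m) w =
     ((if l = j then 1 else 0) - complex_of_real m * (w $ l - z $ l) * cnj (w $ j - z $ j))
       * complex_of_real (exp (- (m * (norm (w - z))\<^sup>2)))"
proof -
  let ?E = "exp (\<Sum>k\<in>UNIV. - complex_of_real m * ((w $ k - z $ k) * cnj (w $ k - z $ k)))"
  let ?c = "cnj (w $ j - z $ j)"
  have coord: "((\<lambda>w. w $ k - z $ k) has_derivative (\<lambda>v. v $ k)) (at w)" for k
    by (auto intro!: derivative_eq_intros bounded_linear.has_derivative[OF bounded_linear_vec_nth])
  note coord_cnj = bounded_linear.has_derivative[OF bounded_linear_cnj coord]
  have "(gauss_peak j z m has_derivative (\<lambda>v. ?c * (?E *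
      (\<Sum>k\<in>UNIV. - complex_of_real m * ((w $ k - z $ k) * cnj (v $ k) + v $ k * cnj (w $ k - z $ k))))
      + cnj (v $ j) * ?E)) (at w)"
    unfolding gauss_peak_def[abs_def]
    by (intro has_derivative_mult coord coord_cnj has_derivative_sum has_derivative_mult_right
        has_derivative_compose[OF _ DERIV_exp[unfolded has_field_derivative_def]])
  moreover have "?c * (?E *
      (\<Sum>k\<in>UNIV. - complex_of_real m * ((w $ k - z $ k) * cnj (v $ k) + v $ k * cnj (w $ k - z $ k))))
      + cnj (v $ j) * ?E =
      (\<Sum>k\<in>UNIV. (- complex_of_real m * ?c * ?E * cnj (w $ k - z $ k)) * v $ k
        + ((if k = j then 1 else 0) - complex_of_real m * (w $ k - z $ k) * ?c) * ?E * cnj (v $ k))" for v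
  proof -
    \<comment> \<open>The term that does not come from the exponential is spread over the sum with a Kronecker delta.\<close>
    have "cnj (v $ j) * ?E = (\<Sum>k\<in>UNIV. if k = j then cnj (v $ k) * ?E else 0)"
      by simp
    then show ?thesis
      by (simp only: sum_distrib_left sum.distrib[symmetric])
        (intro sum.cong refl, simp add: algebra_simps)
  qed
  ultimately have "(gauss_peak j z m has_derivative (\<lambda>v.
      \<Sum>k\<in>UNIV. (- complex_of_real m * ?c * ?E * cnj (w $ k - z $ k)) * v $ k
        + ((if k = j then 1 else 0) - complex_of_real m * (w $ k - z $ k) * ?c) * ?E * cnj (v $ k))) (at w)"
    by (simp only:)
  then have "wirtinger_zbar l (gauss_peak j z m) w =
      ((if l = j then 1 else 0) - complex_of_real m * (w $ l - z $ l) * ?c) * ?E"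
    by (rule wirtinger_zbar_eqI)
  moreover have "?E = complex_of_real (exp (- (m * (norm (w - z))\<^sup>2)))"
    using sum_mult_cnj_eq_norm[of "w - z"]
    by (simp add: sum_negf sum_distrib_left[symmetric] exp_of_real[symmetric] del: exp_of_real)
  ultimately show ?thesis
    by simp
qed

text \<open>
  Writing \<open>x\<close> for \<open>m |w - z|\<^sup>2\<close>, the derivative is at most \<open>(1 + x) * exp (- x)\<close>, and
  \<open>1 + x \<le> 2 * exp (x / 2)\<close>. What matters is that the factor \<open>m\<close> produced by differentiation is
  absorbed by half of the Gaussian, so that the bound is uniform in \<open>m\<close>.
\<close>

lemma norm_wirtinger_zbar_gauss_peak:
  assumes "0 \<le> m"
  shows "cmod (wirtinger_zbar l (gauss_peak j z m) w) \<le> 2 * exp (- (m * (norm (w - z))\<^sup>2) / 2)"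
proof -
  let ?x = "m * (norm (w - z))\<^sup>2"
  have "cmod (complex_of_real m * (w $ l - z $ l) * cnj (w $ j - z $ j)) =
      m * (norm ((w - z) $ l) * norm ((w - z) $ j))"
    using assms by (simp add: norm_mult del: complex_cnj_diff)
  also have "\<dots> \<le> m * (norm (w - z) * norm (w - z))"
    using assms Finite_Cartesian_Product.norm_nth_le[of "w - z"] by (intro mult_left_mono mult_mono) auto
  finally have "cmod ((if l = j then 1 else 0) - complex_of_real m * (w $ l - z $ l) * cnj (w $ j - z $ j))
      \<le> 1 + ?x"
    by (intro order_trans[OF norm_triangle_ineq4] add_mono) (auto simp: power2_eq_square)
  then have "cmod (wirtinger_zbar l (gauss_peak j z m) w) \<le> (1 + ?x) * exp (- ?x)"
    unfolding wirtinger_zbar_gauss_peak norm_mult using assms by (intro mult_mono) auto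
  also have "1 + ?x \<le> 2 * exp (?x / 2)"
    using exp_ge_add_one_self[of "?x / 2"] by linarith
  then have "(1 + ?x) * exp (- ?x) \<le> (2 * exp (?x / 2)) * exp (- ?x)"
    by (rule mult_right_mono) simp
  also have "\<dots> = 2 * exp (- ?x / 2)"
    by (simp add: exp_add[symmetric])
  finally show ?thesis .
qed

lemma dbar_gauss_peak_bound:
  fixes z :: "complex ^ 'n::{finite,linorder}"
  assumes "0 \<le> m"
  shows "(cmod (dbar_monomial (gauss_peak j z m) I M w))\<^sup>2
         \<le> (2 * real CARD('n))\<^sup>2 * exp (- (m * (norm (w - z))\<^sup>2))"
proof -
  let ?x = "m * (norm (w - z))\<^sup>2"
  have "cmod (wedge_coeff l I M * wirtinger_zbar l (gauss_peak j z m) w) \<le> 1 * (2 * exp (- ?x / 2))" for l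
    unfolding norm_mult by (intro mult_mono norm_wirtinger_zbar_gauss_peak assms) (auto simp: wedge_coeff_def norm_power)
  then have "cmod (dbar_monomial (gauss_peak j z m) I M w) \<le> (\<Sum>l\<in>(UNIV :: 'n set). 2 * exp (- ?x / 2))"
    unfolding dbar_monomial_def by (intro sum_norm_le) simp
  then have "(cmod (dbar_monomial (gauss_peak j z m) I M w))\<^sup>2 \<le> (2 * real CARD('n) * exp (- ?x / 2))\<^sup>2"
    by (intro power_mono) (auto simp: mult_ac)
  also have "\<dots> = (2 * real CARD('n))\<^sup>2 * exp (- ?x)"
    by (simp add: power_mult_distrib exp_double[symmetric])
  finally show ?thesis .
qed

lemma dbar_gauss_peak_at_centre:
  fixes z :: "complex ^ 'n::{finite,linorder}"
  assumes "j # I \<in> incr_tuples q"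
  shows "dbar_monomial (gauss_peak j z m) I (j # I) z = 1"
proof -
  have "dbar_monomial (gauss_peak j z m) I (j # I) z =
      (\<Sum>l\<in>UNIV. if l = j then wirtinger_zbar j (gauss_peak j z m) z else 0)"
    unfolding dbar_monomial_def by (intro sum.cong) (auto simp: wedge_coeff_hd[OF assms])
  then show ?thesis
    by (simp add: wirtinger_zbar_gauss_peak)
qed

section \<open>Unboundedness of point evaluation\<close>

theorem theorem1p3:
  fixes \<Omega> :: "(complex ^ 'n::{finite,linorder}) set"
    and q :: nat and z :: "complex ^ 'n::{finite,linorder}" and J :: "'n list"
  assumes "open \<Omega>" and "connected \<Omega>" and "\<Omega> \<noteq> {}"
    and "1 \<le> q" and "q \<le> CARD('n)"
    and "z \<in> \<Omega>" and "J \<in> incr_tuples q"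
  shows "\<not> (\<exists>e. is_evaluation q \<Omega> (L2_forms q \<Omega> \<inter> ker_dbar q \<Omega>) z J e \<and>
               bounded_linear_functional q \<Omega> (L2_forms q \<Omega> \<inter> ker_dbar q \<Omega>) e)"
proof
  let ?H = "L2_forms q \<Omega> \<inter> ker_dbar q \<Omega>"
  assume "\<exists>e. is_evaluation q \<Omega> ?H z J e \<and> bounded_linear_functional q \<Omega> ?H e"
  then obtain e where e: "is_evaluation q \<Omega> ?H z J e" "bounded_linear_functional q \<Omega> ?H e"
    by blast
  then obtain C where C: "\<And>\<phi>. \<phi> \<in> ?H \<Longrightarrow> cmod (e \<phi>) \<le> C * L2_norm q \<Omega> \<phi>"
    unfolding bounded_linear_functional_def by blast
  obtain p where p: "q = Suc p"
    using \<open>1 \<le> q\<close> by (cases q) auto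
  obtain j I where J: "J = j # I"
    using \<open>J \<in> incr_tuples q\<close> p by (cases J) (auto simp: incr_tuples_def)
  have I: "I \<in> incr_tuples p"
    using \<open>J \<in> incr_tuples q\<close> p J by (simp add: incr_tuples_def)
  define \<phi> where "\<phi> n = dbar_monomial (gauss_peak j z (real (Suc n))) I" for n
  define g where "g n w = (2 * real CARD('n))\<^sup>2 * exp (- (real (Suc n) * (norm (w - z))\<^sup>2))" for n w
  define N where "N = real (card (incr_tuples q :: 'n list set))"
  have smooth: "smooth_on S (\<phi> n M)" for S n M
    unfolding \<phi>_def
    by (rule smooth_on_subset[OF smooth_on_dbar_monomial[OF open_UNIV smooth_on_gauss_peak]]) simp
  have g: "integrable lborel (g n)" for n
    unfolding g_def by (intro integrable_mult_right integrable_scaled_gaussian)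
  have bound: "(cmod (\<phi> n M w))\<^sup>2 \<le> g n w" for n M w
    unfolding \<phi>_def g_def by (rule dbar_gauss_peak_bound) simp
  have L2: "\<phi> n \<in> L2_forms q \<Omega>" "0 \<le> L2_norm q \<Omega> (\<phi> n)"
      "L2_norm q \<Omega> (\<phi> n) \<le> sqrt (N * integral\<^sup>L lborel (g n))" for n
    unfolding N_def
    by (rule L2_forms_dominated[OF \<open>open \<Omega>\<close> smooth_on_continuous_on[OF smooth] g bound])+
  have H: "\<phi> n \<in> ?H" for n
    using L2(1)[of n] dbar_monomial_in_ker_dbar[OF \<open>open \<Omega>\<close> smooth_on_gauss_peak I]
    unfolding \<phi>_def p by blast
  \<comment> \<open>The right-hand side tends to zero as \<open>n\<close> grows; the absolute value of \<open>C\<close> makes the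
    estimate of the norm applicable whatever the sign of \<open>C\<close>.\<close>
  have "1 \<le> \<bar>C\<bar> * sqrt (N * integral\<^sup>L lborel (g n))" for n
  proof -
    have "e (\<phi> n) = \<phi> n J z"
      using e(1) H smooth unfolding is_evaluation_def by blast
    also have "\<dots> = 1"
      using dbar_gauss_peak_at_centre[of j I q z] \<open>J \<in> incr_tuples q\<close> by (simp add: \<phi>_def J)
    finally have "1 \<le> C * L2_norm q \<Omega> (\<phi> n)"
      using C[OF H[of n]] by simp
    also have "\<dots> \<le> \<bar>C\<bar> * sqrt (N * integral\<^sup>L lborel (g n))"
    proof (intro mult_mono)
      show "0 \<le> L2_norm q \<Omega> (\<phi> n)"
        by (rule L2(2))
    qed (use L2(3) in auto)
    finally show ?thesis .
  qed
  moreover have "(\<lambda>n. \<bar>C\<bar> * sqrt (N * integral\<^sup>L lborel (g n))) \<longlonglongrightarrow> 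
      \<bar>C\<bar> * sqrt (N * ((2 * real CARD('n))\<^sup>2 * 0))"
    unfolding g_def integral_mult_right_zero
    by (intro tendsto_intros integral_scaled_gaussian_tendsto_0)
  ultimately show False
    by (auto dest!: LIMSEQ_le_const)
qed

end
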